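(* Assume $c_j$ is SOS-concave for every $j\in\mathcal{I}$, $c_j$ is a linear polynomial (degree at most one, constant term allowed) for every $j\in\mathcal{E}$, and $p_i$ is SOS-concave for every $i=1,\ldots,m$. Then $f_{\mathrm{mom},k}=f_{\max}$ for all $k\ge d$. In addition, if the $k$-th order moment relaxation has an optimizer $y^*$, then $v^*=(y^*_{e_1},\ldots,y^*_{e_n})$ is a global maximizer of $\sum_{i=1}^m a_i\log p_i(x)$ over $x\in K$.
   Context: Let $n,m\ge 1$ be integers, $a_1,\ldots,a_m>0$ real numbers, $\mathcal{E}$ and $\mathcal{I}$ finite disjoint label sets, and $p_1,\ldots,p_m$, $c_j$ ($j\in\mathcal{E}\cup\mathcal{I}$) real polynomials in $x=(x_1,\ldots,x_n)$. Let $$K=\{x\in\mathbb{R}^n: c_j(x)=0\ (j\in\mathcal{E}),\ c_j(x)\ge 0\ (j\in\mathcal{I})\}.$$ Standing assumption: $p_i\ge 0$ on $K$ for all $i$, and there is $\hat{x}\in K$ with $p_i(\hat{x})>0$ for all $i=1,\ldots,m$. Convention: $\log t=-\infty$ for $t\le 0$. Optimal values are suprema in the extended reals. A polynomial $q$ is SOS-convex if its Hessian satisfies $\nabla^2 q=R(x)^TR(x)$ for some matrix polynomial $R(x)$ (not necessarily square); $q$ is SOS-concave if $-q$ is SOS-convex. $f_{\max}$ is the optimal value of the log-polynomial optimization problem of maximizing $\sum_{i=1}^m a_i\log p_i(x)$ over $x\in K$. Let $d$ be the maximum of $\lceil\deg(q)/2\rceil$ over all $q\in\{p_1,\ldots,p_m\}\cup\{c_j:j\in\mathcal{E}\cup\mathcal{I}\}$;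 it is understood that $d\ge 1$. For $k\ge 0$ let $\mathbb{N}^n_{k}=\{\alpha\in\mathbb{N}^n:|\alpha|\le k\}$ and $[x]_{k}=(x^\alpha)_{\alpha\in\mathbb{N}^n_{k}}$; $e_i\in\mathbb{N}^n$ is the $i$-th unit vector. For $y=(y_\alpha)\in\mathbb{R}^{\mathbb{N}^n_{2k}}$ and a polynomial $q=\sum_\alpha q_\alpha x^\alpha$ of degree $\le 2k$, put $\langle q,y\rangle=\sum_\alpha q_\alpha y_\alpha$. The moment matrix is $M_k[y]=[y_{\alpha+\beta}]_{\alpha,\beta\in\mathbb{N}^n_k}$; for $\deg q\le 2k$ and $s=k-\lceil\deg(q)/2\rceil$, the localizing matrix $L_q^{(k)}[y]$ is obtained by applying the linear map $x^\alpha\mapsto y_\alpha$ entrywise to $q(x)[x]_s[x]_s^T$. For $k\ge d$, the $k$-th order moment relaxation is to maximize $\sum_{i=1}^m a_i\log\langle p_i,y\rangle$ over $y\in\mathbb{R}^{\mathbb{N}^n_{2k}}$ subject to $y_0=1$, $M_k[y]\succeq 0$, $L_{c_j}^{(k)}[y]=0$ ($j\in\mathcal{E}$), $L_{c_j}^{(k)}[y]\succeq 0$ ($j\in\mathcal{I}$); its optimal value is $f_{\mathrm{mom},k}$. *)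

theory Defs
  imports "HOL-Analysis.Analysis" "HOL-Library.Poly_Mapping"
begin

section \<open>Real polynomials in finitely many variables\<close>

text \<open>The index type \<open>'n\<close> plays the role of \<open>{1, \<dots>, n}\<close>. Polynomials are elements of the
  monoid algebra of the exponents, so that \<open>+\<close>, \<open>-\<close>, \<open>*\<close> from
  \<^theory>\<open>HOL-Library.Poly_Mapping\<close> are the polynomial operations, and
  \<open>Poly_Mapping.lookup q \<alpha>\<close> is the coefficient of \<open>x\<^sup>\<alpha>\<close> in \<open>q\<close>.\<close>

type_synonym 'n expo = "'n \<Rightarrow>\<^sub>0 nat"

type_synonym 'n rpoly = "'n expo \<Rightarrow>\<^sub>0 real"

definition expo_deg :: "'n::finite expo \<Rightarrow> nat" where
  "expo_deg \<alpha> = (\<Sum>i\<in>UNIV. Poly_Mapping.lookup \<alpha> i)"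

definition expos_upto :: "nat \<Rightarrow> 'n::finite expo set" where
  "expos_upto k = {\<alpha>. expo_deg \<alpha> \<le> k}"

definition unit_expo :: "'n \<Rightarrow> 'n expo" where
  "unit_expo i = Poly_Mapping.single i 1"

definition monom_poly :: "'n expo \<Rightarrow> 'n rpoly" where
  "monom_poly \<alpha> = Poly_Mapping.single \<alpha> 1"

definition poly_eval :: "'n::finite rpoly \<Rightarrow> real ^ 'n \<Rightarrow> real" where
  "poly_eval q x =
     (\<Sum>\<alpha>\<in>Poly_Mapping.keys q. Poly_Mapping.lookup q \<alpha> * (\<Prod>i\<in>UNIV. (x $ i) ^ Poly_Mapping.lookup \<alpha> i))"

text \<open>Total degree; the zero polynomial gets degree 0.\<close>

definition poly_deg :: "'n::finite rpoly \<Rightarrow> nat" where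
  "poly_deg q = Max (insert 0 (expo_deg ` Poly_Mapping.keys q))"

definition half_deg :: "'n::finite rpoly \<Rightarrow> nat" where
  "half_deg q = nat \<lceil>real (poly_deg q) / 2\<rceil>"

text \<open>Formal partial derivative. The truncated subtraction \<open>\<alpha> - unit_expo i\<close> is harmless: when
  \<open>\<alpha>\<close> does not involve the variable \<open>i\<close>, the coefficient of the summand is 0.\<close>

definition poly_partial :: "'n \<Rightarrow> 'n::finite rpoly \<Rightarrow> 'n rpoly" where
  "poly_partial i q =
     (\<Sum>\<alpha>\<in>Poly_Mapping.keys q.
        Poly_Mapping.single (\<alpha> - unit_expo i)
          (real (Poly_Mapping.lookup \<alpha> i) * Poly_Mapping.lookup q \<alpha>))"

text \<open>\<open>\<nabla>\<^sup>2 q = R\<^sup>T R\<close> as an identity of polynomial matrices, where \<open>R\<close> has \<open>r\<close> rows (indexed by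
  \<open>{..<r}\<close>, with \<open>r\<close> arbitrary) and its columns are indexed by the variables.\<close>

definition sos_convex :: "'n::finite rpoly \<Rightarrow> bool" where
  "sos_convex q \<longleftrightarrow>
     (\<exists>(r::nat) (R :: nat \<Rightarrow> 'n \<Rightarrow> 'n rpoly).
        \<forall>i j. poly_partial i (poly_partial j q) = (\<Sum>l<r. R l i * R l j))"

definition sos_concave :: "'n::finite rpoly \<Rightarrow> bool" where
  "sos_concave q \<longleftrightarrow> sos_convex (- q)"


section \<open>Log-polynomial optimization\<close>

definition ext_log :: "real \<Rightarrow> ereal" where
  "ext_log t = (if t \<le> 0 then - \<infinity> else ereal (ln t))"

text \<open>For \<open>a i > 0\<close> each summand below is real or \<open>- \<infinity>\<close>, so the sum is \<open>- \<infinity>\<close> as soon as one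
  \<open>t i\<close> is not positive.\<close>

definition weighted_log_sum :: "nat \<Rightarrow> (nat \<Rightarrow> real) \<Rightarrow> (nat \<Rightarrow> real) \<Rightarrow> ereal" where
  "weighted_log_sum m a t = (\<Sum>i = 1..m. ereal (a i) * ext_log (t i))"

definition feasible_set ::
    "'l set \<Rightarrow> 'l set \<Rightarrow> ('l \<Rightarrow> 'n::finite rpoly) \<Rightarrow> (real ^ 'n) set" where
  "feasible_set E I c = {x. (\<forall>j\<in>E. poly_eval (c j) x = 0) \<and> (\<forall>j\<in>I. poly_eval (c j) x \<ge> 0)}"

definition log_poly_obj ::
    "nat \<Rightarrow> (nat \<Rightarrow> real) \<Rightarrow> (nat \<Rightarrow> 'n::finite rpoly) \<Rightarrow> real ^ 'n \<Rightarrow> ereal" where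
  "log_poly_obj m a p x = weighted_log_sum m a (\<lambda>i. poly_eval (p i) x)"

definition f_max ::
    "nat \<Rightarrow> (nat \<Rightarrow> real) \<Rightarrow> (nat \<Rightarrow> 'n::finite rpoly) \<Rightarrow> 'l set \<Rightarrow> 'l set \<Rightarrow> ('l \<Rightarrow> 'n rpoly) \<Rightarrow> ereal"
  where
  "f_max m a p E I c = (SUP x\<in>feasible_set E I c. log_poly_obj m a p x)"


section \<open>Moment relaxations\<close>

text \<open>The lower bound 1 is part of the convention; it matters only if all polynomials are constant.\<close>

definition min_order ::
    "nat \<Rightarrow> (nat \<Rightarrow> 'n::finite rpoly) \<Rightarrow> 'l set \<Rightarrow> 'l set \<Rightarrow> ('l \<Rightarrow> 'n rpoly) \<Rightarrow> nat" where
  "min_order m p E I c = Max (insert 1 (half_deg ` (p ` {1..m} \<union> c ` (E \<union> I))))"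

definition riesz :: "'n::finite rpoly \<Rightarrow> ('n expo \<Rightarrow> real) \<Rightarrow> real" where
  "riesz q y = (\<Sum>\<alpha>\<in>Poly_Mapping.keys q. Poly_Mapping.lookup q \<alpha> * y \<alpha>)"

text \<open>Matrices with rows and columns indexed by a finite set \<open>S\<close> are functions of two arguments,
  of which only the values on \<open>S\<close> are relevant.\<close>

definition psd_on :: "'b set \<Rightarrow> ('b \<Rightarrow> 'b \<Rightarrow> real) \<Rightarrow> bool" where
  "psd_on S A \<longleftrightarrow>
     (\<forall>i\<in>S. \<forall>j\<in>S. A i j = A j i) \<and>
     (\<forall>v. 0 \<le> (\<Sum>i\<in>S. \<Sum>j\<in>S. v i * A i j * v j))"

definition moment_matrix :: "('n::finite expo \<Rightarrow> real) \<Rightarrow> 'n expo \<Rightarrow> 'n expo \<Rightarrow> real" where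
  "moment_matrix y \<alpha> \<beta> = y (\<alpha> + \<beta>)"

text \<open>The entry of \<open>L\<^sub>q[y]\<close> at \<open>(\<alpha>, \<beta>)\<close>. The matrix of order \<open>k\<close> is the restriction to
  \<open>\<alpha>, \<beta> \<in> expos_upto (k - half_deg q)\<close>.\<close>

definition localizing_matrix ::
    "'n::finite rpoly \<Rightarrow> ('n expo \<Rightarrow> real) \<Rightarrow> 'n expo \<Rightarrow> 'n expo \<Rightarrow> real" where
  "localizing_matrix q y \<alpha> \<beta> = riesz (q * monom_poly \<alpha> * monom_poly \<beta>) y"

text \<open>Membership in \<^const>\<open>extensional\<close> says that \<open>y\<close> carries no information outside
  \<open>expos_upto (2 * k)\<close>, i.e. that it represents an element of
  \<open>\<real>\<close> to the power \<open>expos_upto (2 * k)\<close>.\<close>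

definition mom_feasible ::
    "'l set \<Rightarrow> 'l set \<Rightarrow> ('l \<Rightarrow> 'n::finite rpoly) \<Rightarrow> nat \<Rightarrow> ('n expo \<Rightarrow> real) set" where
  "mom_feasible E I c k =
     {y \<in> extensional (expos_upto (2 * k)).
        y 0 = 1 \<and>
        psd_on (expos_upto k) (moment_matrix y) \<and>
        (\<forall>j\<in>E. \<forall>\<alpha>\<in>expos_upto (k - half_deg (c j)). \<forall>\<beta>\<in>expos_upto (k - half_deg (c j)).
           localizing_matrix (c j) y \<alpha> \<beta> = 0) \<and>
        (\<forall>j\<in>I. psd_on (expos_upto (k - half_deg (c j))) (localizing_matrix (c j) y))}"

definition mom_obj ::
    "nat \<Rightarrow> (nat \<Rightarrow> real) \<Rightarrow> (nat \<Rightarrow> 'n::finite rpoly) \<Rightarrow> ('n expo \<Rightarrow> real) \<Rightarrow> ereal" where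
  "mom_obj m a p y = weighted_log_sum m a (\<lambda>i. riesz (p i) y)"

definition f_mom ::
    "nat \<Rightarrow> (nat \<Rightarrow> real) \<Rightarrow> (nat \<Rightarrow> 'n::finite rpoly) \<Rightarrow> 'l set \<Rightarrow> 'l set \<Rightarrow> ('l \<Rightarrow> 'n rpoly) \<Rightarrow> nat \<Rightarrow> ereal"
  where
  "f_mom m a p E I c k = (SUP y\<in>mom_feasible E I c k. mom_obj m a p y)"

end

theory Submission
  imports Defs "HOL-Computational_Algebra.Polynomial"
begin

text \<open>The two optimal values are compared by maps between the two feasible sets. A point \<open>x \<in> K\<close>
  gives the moment sequence \<open>y\<^sub>\<alpha> = x\<^sup>\<alpha>\<close>, which is feasible and has the same objective value
  (\<open>moments_of_point_feasible\<close>); so every relaxation is an upper bound. In the other direction a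
  feasible \<open>y\<close> is sent to its mean \<open>v\<close>, the vector of its first-order entries. The corner entry
  of each localizing matrix says that the Riesz functional of \<open>c\<^sub>j\<close> at \<open>y\<close> is zero or nonnegative.
  For affine \<open>c\<^sub>j\<close> this number is \<open>c\<^sub>j(v)\<close>, and for SOS-concave \<open>c\<^sub>j\<close> and \<open>p\<^sub>i\<close> it is at most the
  value at \<open>v\<close>, by Jensen's inequality for SOS-concave polynomials (\<open>sos_concave_jensen\<close>). Hence
  \<open>v \<in> K\<close>, and since the logarithm is increasing and the weights are positive, the objective at
  \<open>v\<close> is at least the relaxed objective at \<open>y\<close>. Equality of the values and optimality of the
  mean of an optimizer follow.

  The content is therefore Jensen's inequality, although \<open>y\<close> need not have a representing measure.
  It does always have a signed one: any functional on polynomials of bounded degree is a finite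
  combination \<open>\<Sum>\<^sub>f w\<^sub>f \<delta>\<close> of evaluations at grid points \<open>P\<^sub>f\<close> (\<open>quadrature\<close>), with weights of
  arbitrary sign. This suffices to turn the usual Taylor argument into calculus in one real
  variable. For SOS-convex \<open>q\<close> put \<open>g(s) = \<Sum>\<^sub>f w\<^sub>f q(v + s(P\<^sub>f - v))\<close>. Then \<open>g(0) = q(v)\<close>,
  \<open>g(1)\<close> is the Riesz functional of \<open>q\<close>, and \<open>g'(0) = 0\<close> because \<open>v\<close> is the mean. The second
  derivative \<open>g''(s)\<close> is the functional applied to \<open>(x - v)\<^sup>T \<nabla>\<^sup>2q(v + s(x - v)) (x - v)\<close>, a sum of
  squares of the entries of \<open>R(v + s(x - v)) (x - v)\<close>. These entries have degree at most \<open>k\<close>, as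
  leading terms of a sum of squares cannot cancel (\<open>expo_deg_sum_of_squares\<close>), so positivity of
  the moment matrix gives \<open>g'' \<ge> 0\<close> and thus \<open>g(0) \<le> g(1)\<close>.\<close>

section \<open>Exponents and the Riesz functional\<close>

lemma expo_deg_add: "expo_deg (\<alpha> + \<beta>) = expo_deg \<alpha> + expo_deg \<beta>"
  by (simp add: expo_deg_def lookup_add sum.distrib)

lemma expo_deg_0 [simp]: "expo_deg 0 = 0"
  by (simp add: expo_deg_def)

lemma expo_deg_unit [simp]: "expo_deg (unit_expo i) = 1"
  by (simp add: expo_deg_def unit_expo_def lookup_single when_def)

lemma lookup_le_expo_deg: "Poly_Mapping.lookup \<alpha> i \<le> expo_deg \<alpha>"
  unfolding expo_deg_def by (rule member_le_sum) auto

lemma zero_in_expos_upto [simp]: "0 \<in> expos_upto k"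
  by (simp add: expos_upto_def)

lemma finite_expos_upto [simp]: "finite (expos_upto k :: 'n::finite expo set)"
proof (rule finite_imageD)
  have "Poly_Mapping.lookup ` (expos_upto k :: 'n expo set) \<subseteq> PiE UNIV (\<lambda>_. {..k})"
    by (auto simp: expos_upto_def intro: order_trans[OF lookup_le_expo_deg])
  then show "finite (Poly_Mapping.lookup ` (expos_upto k :: 'n expo set))"
    by (rule finite_subset) (simp add: finite_PiE)
qed (simp add: inj_on_def)

text \<open>An exponent of degree one is the exponent of a variable, which is how affine polynomials
  are recognized.\<close>

lemma expo_deg_le_1_cases:
  assumes "expo_deg \<alpha> \<le> 1"
  obtains "\<alpha> = 0" | i where "\<alpha> = unit_expo i"
proof (cases "\<alpha> = 0")
  case False
  then obtain i where i: "Poly_Mapping.lookup \<alpha> i \<noteq> 0"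
    by (metis lookup_zero poly_mapping_eqI)
  have "(\<Sum>j\<in>UNIV. Poly_Mapping.lookup \<alpha> j)
      = Poly_Mapping.lookup \<alpha> i + (\<Sum>j\<in>UNIV - {i}. Poly_Mapping.lookup \<alpha> j)"
    by (rule sum.remove) auto
  then have one: "Poly_Mapping.lookup \<alpha> i = 1" "(\<Sum>j\<in>UNIV - {i}. Poly_Mapping.lookup \<alpha> j) = 0"
    using assms i unfolding expo_deg_def by linarith+
  then have "\<forall>j. j \<noteq> i \<longrightarrow> Poly_Mapping.lookup \<alpha> j = 0"
    by simp
  then have "\<alpha> = unit_expo i"
    using one(1) by (intro poly_mapping_eqI) (auto simp: unit_expo_def lookup_single when_def)
  then show ?thesis by (rule that(2))
qed (rule that(1))

lemma riesz_superset:
  assumes "finite S" "Poly_Mapping.keys q \<subseteq> S"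
  shows "riesz q y = (\<Sum>\<alpha>\<in>S. Poly_Mapping.lookup q \<alpha> * y \<alpha>)"
  unfolding riesz_def using assms by (intro sum.mono_neutral_left) (auto simp: in_keys_iff)

lemma riesz_cong: "(\<And>\<alpha>. \<alpha> \<in> Poly_Mapping.keys q \<Longrightarrow> y \<alpha> = z \<alpha>) \<Longrightarrow> riesz q y = riesz q z"
  by (simp add: riesz_def)

lemma riesz_0 [simp]: "riesz 0 y = 0"
  by (simp add: riesz_def)

lemma riesz_single: "riesz (Poly_Mapping.single \<alpha> r) y = r * y \<alpha>"
  by (simp add: riesz_def)

lemma keys_monom_poly: "Poly_Mapping.keys (monom_poly \<alpha>) = {\<alpha>}"
  by (simp add: monom_poly_def)

lemma riesz_monom_poly: "riesz (monom_poly \<alpha>) y = y \<alpha>"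
  by (simp add: monom_poly_def riesz_single)

lemma riesz_add: "riesz (p + q) y = riesz p y + riesz q y"
proof -
  let ?S = "Poly_Mapping.keys p \<union> Poly_Mapping.keys q"
  have "Poly_Mapping.keys (p + q) \<subseteq> ?S" by (rule keys_add)
  then show ?thesis
    by (simp add: riesz_superset[of ?S] lookup_add sum.distrib distrib_right)
qed

lemma keys_uminus_rpoly: "Poly_Mapping.keys (- q) = Poly_Mapping.keys (q :: 'n rpoly)"
  by (auto simp: in_keys_iff)

lemma riesz_uminus: "riesz (- q) y = - riesz q y"
  by (simp add: riesz_def keys_uminus_rpoly sum_negf)

lemma riesz_sum: "riesz (\<Sum>i\<in>A. q i) y = (\<Sum>i\<in>A. riesz (q i) y)"
  by (induction A rule: infinite_finite_induct) (auto simp: riesz_add)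

text \<open>Bilinearity reduces a product to the products of monomials. With \<open>y\<close> a sequence of
  monomial values this is multiplicativity of evaluation, with \<open>y\<close> an indicator it is the
  convolution formula for coefficients, and with \<open>p = q\<close> it is the quadratic form of the moment
  matrix.\<close>

lemma riesz_mult:
  "riesz (p * q) y = (\<Sum>\<alpha>\<in>Poly_Mapping.keys p. \<Sum>\<beta>\<in>Poly_Mapping.keys q.
     Poly_Mapping.lookup p \<alpha> * Poly_Mapping.lookup q \<beta> * y (\<alpha> + \<beta>))"
proof -
  have decomp: "r = (\<Sum>\<alpha>\<in>Poly_Mapping.keys r. Poly_Mapping.single \<alpha> (Poly_Mapping.lookup r \<alpha>))"
    for r :: "'a rpoly"
    by (rule poly_mapping_eqI)
      (auto simp: lookup_sum lookup_single when_def in_keys_iff sum.delta' sum.delta)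
  have "p * q = (\<Sum>\<alpha>\<in>Poly_Mapping.keys p. \<Sum>\<beta>\<in>Poly_Mapping.keys q.
      Poly_Mapping.single (\<alpha> + \<beta>) (Poly_Mapping.lookup p \<alpha> * Poly_Mapping.lookup q \<beta>))"
    by (subst decomp[of p], subst decomp[of q]) (simp only: sum_product mult_single)
  then show ?thesis
    by (simp add: riesz_sum riesz_single)
qed

lemma riesz_indicator: "riesz q (\<lambda>\<gamma>. if \<gamma> = \<delta> then 1 else 0) = Poly_Mapping.lookup q \<delta>"
  by (auto simp: riesz_def in_keys_iff if_distrib cong: if_cong)

section \<open>Evaluation of polynomials\<close>

definition monom_eval :: "real ^ 'n::finite \<Rightarrow> 'n expo \<Rightarrow> real" where
  "monom_eval x \<alpha> = (\<Prod>i\<in>UNIV. (x $ i) ^ Poly_Mapping.lookup \<alpha> i)"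

lemma monom_eval_add: "monom_eval x (\<alpha> + \<beta>) = monom_eval x \<alpha> * monom_eval x \<beta>"
  by (simp add: monom_eval_def lookup_add power_add prod.distrib)

lemma monom_eval_0 [simp]: "monom_eval x 0 = 1"
  by (simp add: monom_eval_def)

lemma monom_eval_unit [simp]: "monom_eval x (unit_expo i) = x $ i"
  by (simp add: monom_eval_def unit_expo_def lookup_single when_def if_distrib cong: if_cong)

text \<open>Evaluation at a point is the Riesz functional of the moments of the point mass.\<close>

lemma poly_eval_eq_riesz: "poly_eval q x = riesz q (monom_eval x)"
  by (simp add: poly_eval_def riesz_def monom_eval_def)

lemma poly_eval_mult: "poly_eval (p * q) x = poly_eval p x * poly_eval q x"
  unfolding poly_eval_eq_riesz riesz_mult
  by (simp add: riesz_def sum_product monom_eval_add mult_ac)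

lemma poly_eval_add: "poly_eval (p + q) x = poly_eval p x + poly_eval q x"
  by (simp add: poly_eval_eq_riesz riesz_add)

lemma poly_eval_uminus: "poly_eval (- q) x = - poly_eval q x"
  by (simp add: poly_eval_eq_riesz riesz_uminus)

lemma poly_eval_sum: "poly_eval (\<Sum>i\<in>A. q i) x = (\<Sum>i\<in>A. poly_eval (q i) x)"
  by (simp add: poly_eval_eq_riesz riesz_sum)

lemma poly_eval_monom_poly: "poly_eval (monom_poly \<alpha>) x = monom_eval x \<alpha>"
  by (simp add: poly_eval_eq_riesz riesz_monom_poly)

lemma keys_subset_expos_upto_iff:
  "Poly_Mapping.keys q \<subseteq> expos_upto k \<longleftrightarrow> poly_deg q \<le> k"
  by (auto simp: expos_upto_def poly_deg_def)

lemma keys_mult_subset_expos_upto: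
  assumes "Poly_Mapping.keys p \<subseteq> expos_upto j" "Poly_Mapping.keys q \<subseteq> expos_upto k"
  shows "Poly_Mapping.keys (p * q) \<subseteq> expos_upto (j + k)"
proof
  fix \<gamma> assume "\<gamma> \<in> Poly_Mapping.keys (p * q)"
  then obtain \<alpha> \<beta> where "\<gamma> = \<alpha> + \<beta>" "\<alpha> \<in> Poly_Mapping.keys p" "\<beta> \<in> Poly_Mapping.keys q"
    using keys_mult[of p q] by blast
  with assms have "\<gamma> = \<alpha> + \<beta>" "expo_deg \<alpha> \<le> j" "expo_deg \<beta> \<le> k"
    by (auto simp: expos_upto_def)
  then show "\<gamma> \<in> expos_upto (j + k)"
    by (simp add: expos_upto_def expo_deg_add)
qed

text \<open>Polynomial functions with a degree bound. On functions, composition with an affine map is just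
  composition, so no formal substitution into coefficients has to be set up.\<close>

definition polyfuns :: "nat \<Rightarrow> (real ^ 'n::finite \<Rightarrow> real) set" where
  "polyfuns k = {poly_eval q | q. Poly_Mapping.keys q \<subseteq> expos_upto k}"

lemma polyfuns_mono: "f \<in> polyfuns j \<Longrightarrow> j \<le> k \<Longrightarrow> f \<in> polyfuns k"
  by (fastforce simp: polyfuns_def expos_upto_def)

lemma polyfuns_const: "(\<lambda>x. r) \<in> polyfuns k"
proof -
  have "(\<lambda>x. r) = poly_eval (Poly_Mapping.single 0 r)"
    by (auto simp: poly_eval_eq_riesz riesz_single)
  moreover have "Poly_Mapping.keys (Poly_Mapping.single 0 r) \<subseteq> expos_upto k"
    by simp
  ultimately show ?thesis unfolding polyfuns_def by blast
qed

lemma polyfuns_add: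
  assumes "f \<in> polyfuns k" "g \<in> polyfuns k"
  shows "(\<lambda>x. f x + g x) \<in> polyfuns k"
proof -
  obtain p q where p: "f = poly_eval p" "Poly_Mapping.keys p \<subseteq> expos_upto k"
    and q: "g = poly_eval q" "Poly_Mapping.keys q \<subseteq> expos_upto k"
    using assms by (auto simp: polyfuns_def)
  have "Poly_Mapping.keys (p + q) \<subseteq> expos_upto k"
    using keys_add[of p q] p q by blast
  moreover have "(\<lambda>x. f x + g x) = poly_eval (p + q)"
    by (simp add: fun_eq_iff p q poly_eval_add)
  ultimately show ?thesis unfolding polyfuns_def by blast
qed

lemma polyfuns_sum: "(\<And>i. i \<in> A \<Longrightarrow> f i \<in> polyfuns k) \<Longrightarrow> (\<lambda>x. \<Sum>i\<in>A. f i x) \<in> polyfuns k"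
  by (induction A rule: infinite_finite_induct) (auto intro: polyfuns_add polyfuns_const)

lemma polyfuns_mult:
  assumes "f \<in> polyfuns j" "g \<in> polyfuns k"
  shows "(\<lambda>x. f x * g x) \<in> polyfuns (j + k)"
proof -
  obtain p q where p: "f = poly_eval p" "Poly_Mapping.keys p \<subseteq> expos_upto j"
    and q: "g = poly_eval q" "Poly_Mapping.keys q \<subseteq> expos_upto k"
    using assms by (auto simp: polyfuns_def)
  have "Poly_Mapping.keys (p * q) \<subseteq> expos_upto (j + k)"
    using keys_mult_subset_expos_upto[OF p(2) q(2)] .
  moreover have "(\<lambda>x. f x * g x) = poly_eval (p * q)"
    by (simp add: fun_eq_iff p q poly_eval_mult)
  ultimately show ?thesis unfolding polyfuns_def by blast
qed

lemma polyfuns_prod: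
  "finite A \<Longrightarrow> (\<And>i. i \<in> A \<Longrightarrow> f i \<in> polyfuns (k i)) \<Longrightarrow>
    (\<lambda>x. \<Prod>i\<in>A. f i x) \<in> polyfuns (\<Sum>i\<in>A. k i)"
  by (induction A rule: finite_induct) (auto intro: polyfuns_mult polyfuns_const)

lemma polyfuns_power:
  assumes "f \<in> polyfuns 1"
  shows "(\<lambda>x. f x ^ e) \<in> polyfuns e"
proof (induction e)
  case (Suc e)
  from polyfuns_mult[OF assms Suc] show ?case by simp
qed (simp add: polyfuns_const)

lemma polyfuns_coord: "(\<lambda>x. x $ i) \<in> polyfuns 1"
proof -
  have "(\<lambda>x. x $ i) = poly_eval (monom_poly (unit_expo i))"
    by (simp add: fun_eq_iff poly_eval_monom_poly)
  moreover have "Poly_Mapping.keys (monom_poly (unit_expo i)) \<subseteq> expos_upto 1"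
    by (simp add: keys_monom_poly expos_upto_def)
  ultimately show ?thesis unfolding polyfuns_def by blast
qed

lemma polyfuns_diff_coord: "(\<lambda>x. (x - v) $ i) \<in> polyfuns 1"
  using polyfuns_add[OF polyfuns_coord[of i] polyfuns_const[of "- v $ i"]] by simp

text \<open>Each monomial becomes a product of as many affine factors as its degree, so the substitution
  does not raise the degree.\<close>

lemma polyfuns_homothety:
  assumes "f \<in> polyfuns k"
  shows "(\<lambda>x. f (v + s *\<^sub>R (x - v))) \<in> polyfuns k"
proof -
  obtain q where q: "f = poly_eval q" "Poly_Mapping.keys q \<subseteq> expos_upto k"
    using assms by (auto simp: polyfuns_def)
  have lin: "(\<lambda>x. v $ i + s * (x - v) $ i) \<in> polyfuns 1" for i
    using polyfuns_add[OF polyfuns_const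
        polyfuns_mult[OF polyfuns_const[of s 0] polyfuns_diff_coord[of v i], simplified]] by simp
  have "(\<lambda>x. Poly_Mapping.lookup q \<alpha>
      * (\<Prod>i\<in>UNIV. (v $ i + s * (x - v) $ i) ^ Poly_Mapping.lookup \<alpha> i)) \<in> polyfuns k"
    if "\<alpha> \<in> Poly_Mapping.keys q" for \<alpha>
  proof -
    have "(\<lambda>x. Poly_Mapping.lookup q \<alpha>
      * (\<Prod>i\<in>UNIV. (v $ i + s * (x - v) $ i) ^ Poly_Mapping.lookup \<alpha> i))
      \<in> polyfuns (0 + (\<Sum>i\<in>UNIV. Poly_Mapping.lookup \<alpha> i))"
      by (intro polyfuns_mult polyfuns_const polyfuns_prod polyfuns_power lin) auto
    then show ?thesis
      using that q by (auto simp: expos_upto_def expo_deg_def elim: polyfuns_mono)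
  qed
  then have "(\<lambda>x. \<Sum>\<alpha>\<in>Poly_Mapping.keys q. Poly_Mapping.lookup q \<alpha>
      * (\<Prod>i\<in>UNIV. (v $ i + s * (x - v) $ i) ^ Poly_Mapping.lookup \<alpha> i)) \<in> polyfuns k"
    by (rule polyfuns_sum)
  then show ?thesis
    by (simp add: q poly_eval_def)
qed

section \<open>Quadrature for truncated moment sequences\<close>

text \<open>The Lagrange basis \<open>\<ell>\<^sub>g\<close> on the nodes \<open>0, \<dots>, N\<close> reproduces \<open>t\<^sup>j = \<Sum>\<^sub>g g\<^sup>j \<ell>\<^sub>g(t)\<close> for
  \<open>j \<le> N\<close>. Comparing the coefficients of \<open>t\<^sup>i\<close> shows that \<open>C g i\<close>, the \<open>i\<close>-th coefficient
  of \<open>\<ell>\<^sub>g\<close>, inverts the Vandermonde matrix.\<close>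

lemma inverse_vandermonde:
  obtains C :: "nat \<Rightarrow> nat \<Rightarrow> real" where
    "\<And>i j. i \<le> N \<Longrightarrow> j \<le> N \<Longrightarrow> (\<Sum>g\<le>N. C g i * real g ^ j) = (if i = j then 1 else 0)"
proof -
  define l where "l g = (\<Prod>h\<in>{..N}-{g}. smult (1 / (real g - real h)) [:- real h, 1:])" for g :: nat
  have lin: "poly (smult r [:- a, 1:]) z = r * (z - a)" for r a z :: real
    by (simp add: algebra_simps)
  have lval: "poly (l g) (real x) = (if x = g then 1 else 0)" if "g \<le> N" "x \<le> N" for g x
  proof (cases "x = g")
    case True
    have "poly (l g) (real g) = 1"
      unfolding l_def poly_prod lin by (intro prod.neutral) auto
    with True show ?thesis by simp
  next
    case False
    then show ?thesis using that
      by (auto simp: l_def poly_prod lin intro!: prod_zero)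
  qed
  have ldeg: "degree (l g) \<le> N" if "g \<le> N" for g
  proof -
    have "degree (l g) \<le> sum (degree \<circ> (\<lambda>h. smult (1 / (real g - real h)) [:- real h, 1:])) ({..N}-{g})"
      unfolding l_def by (rule degree_prod_sum_le) auto
    also have "\<dots> \<le> (\<Sum>h\<in>{..N}-{g}. 1)"
      by (intro sum_mono) simp
    also have "\<dots> = N" using that by simp
    finally show ?thesis .
  qed
  have interp: "(\<Sum>g\<le>N. smult (real g ^ j) (l g)) = monom 1 j" if "j \<le> N" for j
  proof (rule poly_eqI_degree[of "real ` {..N}"])
    fix x assume "x \<in> real ` {..N}"
    then obtain h where h: "h \<le> N" "x = real h" by auto
    have "poly (\<Sum>g\<le>N. smult (real g ^ j) (l g)) x = (\<Sum>g\<le>N. if g = h then real g ^ j else 0)"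
      unfolding poly_sum h by (intro sum.cong) (auto simp: lval h)
    then show "poly (\<Sum>g\<le>N. smult (real g ^ j) (l g)) x = poly (monom 1 j) x"
      using h by (simp add: poly_monom)
  next
    have card: "card (real ` {..N}) = Suc N" by (simp add: card_image)
    show "card (real ` {..N}) > degree (\<Sum>g\<le>N. smult (real g ^ j) (l g))"
      unfolding card less_Suc_eq_le
      by (intro degree_sum_le) (auto intro: order_trans[OF degree_smult_le] ldeg)
    show "card (real ` {..N}) > degree (monom (1::real) j)"
      unfolding card using that by (simp add: degree_monom_eq)
  qed
  have "(\<Sum>g\<le>N. coeff (l g) i * real g ^ j) = (if i = j then 1 else 0)" if "j \<le> N" for i j
    using arg_cong[OF interp[OF that], of "\<lambda>q. coeff q i"]
    by (auto simp: coeff_sum mult.commute)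
  then show ?thesis by (intro that[of "\<lambda>g i. coeff (l g) i"])
qed

text \<open>Every linear functional on polynomials of degree at most \<open>N\<close> is a combination of evaluations at
  the points of the grid \<open>{0, \<dots>, N}\<^sup>n\<close>: the tensor power of the inverse Vandermonde matrix
  yields the weights. They may be negative, so this expresses no positivity of \<open>y\<close>.\<close>

lemma quadrature:
  fixes y :: "'n::finite expo \<Rightarrow> real"
  obtains F :: "('n \<Rightarrow> nat) set" and w and P :: "('n \<Rightarrow> nat) \<Rightarrow> real ^ 'n" where
    "\<And>q. Poly_Mapping.keys q \<subseteq> expos_upto N \<Longrightarrow> riesz q y = (\<Sum>f\<in>F. w f * poly_eval q (P f))"
proof -
  obtain C :: "nat \<Rightarrow> nat \<Rightarrow> real" where
    C: "\<And>i j. i \<le> N \<Longrightarrow> j \<le> N \<Longrightarrow> (\<Sum>g\<le>N. C g i * real g ^ j) = (if i = j then 1 else 0)"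
    using inverse_vandermonde[of N] by blast
  define F :: "('n \<Rightarrow> nat) set" where "F = PiE UNIV (\<lambda>_. {..N})"
  define P :: "('n \<Rightarrow> nat) \<Rightarrow> real ^ 'n" where "P f = (\<chi> i. real (f i))" for f
  \<comment> \<open>The functional applied to the tensor Lagrange polynomial of the node \<open>f\<close>.\<close>
  define w where "w f = (\<Sum>b\<in>F. (\<Prod>i\<in>UNIV. C (f i) (b i)) * y (Abs_poly_mapping b))" for f
  have [simp]: "finite F" unfolding F_def by (intro finite_PiE) auto
  have moments: "(\<Sum>f\<in>F. w f * monom_eval (P f) \<alpha>) = y \<alpha>" if "\<alpha> \<in> expos_upto N" for \<alpha>
  proof -
    have le: "Poly_Mapping.lookup \<alpha> i \<le> N" for i
      using that lookup_le_expo_deg[of \<alpha> i] by (auto simp: expos_upto_def)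
    have "(\<Sum>f\<in>F. w f * monom_eval (P f) \<alpha>)
        = (\<Sum>f\<in>F. \<Sum>b\<in>F. y (Abs_poly_mapping b)
            * (\<Prod>i\<in>UNIV. C (f i) (b i) * real (f i) ^ Poly_Mapping.lookup \<alpha> i))"
      by (simp add: w_def sum_distrib_right sum_distrib_left monom_eval_def P_def prod.distrib mult_ac)
    also have "\<dots> = (\<Sum>b\<in>F. y (Abs_poly_mapping b)
        * (\<Sum>f\<in>F. \<Prod>i\<in>UNIV. C (f i) (b i) * real (f i) ^ Poly_Mapping.lookup \<alpha> i))"
      by (subst sum.swap) (simp add: sum_distrib_left)
    also have "\<dots> = (\<Sum>b\<in>F. y (Abs_poly_mapping b)
        * (\<Prod>i\<in>UNIV. \<Sum>g\<le>N. C g (b i) * real g ^ Poly_Mapping.lookup \<alpha> i))"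
      by (subst prod_sum_PiE) (auto simp: F_def)
    also have "\<dots> = (\<Sum>b\<in>F. if b = Poly_Mapping.lookup \<alpha> then y (Abs_poly_mapping b) else 0)"
    proof (rule sum.cong[OF refl])
      fix b assume "b \<in> F"
      then have "(\<Prod>i\<in>UNIV. \<Sum>g\<le>N. C g (b i) * real g ^ Poly_Mapping.lookup \<alpha> i)
          = (\<Prod>i\<in>UNIV. if b i = Poly_Mapping.lookup \<alpha> i then 1 else 0)"
        using le by (intro prod.cong refl C) (auto simp: F_def PiE_def Pi_def)
      also have "\<dots> = (if b = Poly_Mapping.lookup \<alpha> then 1 else 0)"
        by (auto simp: fun_eq_iff)
      finally show "y (Abs_poly_mapping b)
          * (\<Prod>i\<in>UNIV. \<Sum>g\<le>N. C g (b i) * real g ^ Poly_Mapping.lookup \<alpha> i)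
        = (if b = Poly_Mapping.lookup \<alpha> then y (Abs_poly_mapping b) else 0)" by simp
    qed
    also have "\<dots> = y \<alpha>"
    proof -
      have "Poly_Mapping.lookup \<alpha> \<in> F" using le unfolding F_def by auto
      then show ?thesis by (simp add: lookup_inverse)
    qed
    finally show ?thesis .
  qed
  have "riesz q y = (\<Sum>f\<in>F. w f * poly_eval q (P f))"
    if "Poly_Mapping.keys q \<subseteq> expos_upto N" for q
  proof -
    have "riesz q y = (\<Sum>\<alpha>\<in>Poly_Mapping.keys q. Poly_Mapping.lookup q \<alpha>
        * (\<Sum>f\<in>F. w f * monom_eval (P f) \<alpha>))"
      unfolding riesz_def using that by (intro sum.cong) (auto simp: moments)
    also have "\<dots> = (\<Sum>f\<in>F. w f * poly_eval q (P f))"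
      unfolding poly_eval_eq_riesz riesz_def sum_distrib_left
      by (subst sum.swap) (simp add: mult_ac)
    finally show ?thesis .
  qed
  then show ?thesis by (rule that)
qed


section \<open>Hessians that are sums of squares\<close>

lemma lookup_mult_keys:
  "Poly_Mapping.lookup (p * q) \<delta> = (\<Sum>\<alpha>\<in>Poly_Mapping.keys p. \<Sum>\<beta>\<in>Poly_Mapping.keys q.
     Poly_Mapping.lookup p \<alpha> * Poly_Mapping.lookup q \<beta> * (if \<alpha> + \<beta> = \<delta> then 1 else 0))"
  for p q :: "'n::finite rpoly"
  unfolding riesz_indicator[symmetric] riesz_mult ..

text \<open>Ordering first by degree and then by the Euclidean norm picks a maximal exponent \<open>\<mu>\<close> that is a
  vertex of the convex hull of \<open>S\<close>: if \<open>\<alpha> + \<beta> = 2\<mu>\<close>, then \<open>\<alpha>\<close> and \<open>\<beta>\<close> also have maximal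
  degree, and the parallelogram identity bounds \<open>|\<alpha> - \<beta>|\<^sup>2\<close> by zero. The norm replaces a monomial
  order, which would need an ordering of the variables.\<close>

lemma expos_extreme_point:
  fixes S :: "'n::finite expo set"
  assumes "finite S" "S \<noteq> {}"
  obtains \<mu> where "\<mu> \<in> S" "\<And>\<alpha>. \<alpha> \<in> S \<Longrightarrow> expo_deg \<alpha> \<le> expo_deg \<mu>"
    "\<And>\<alpha> \<beta>. \<alpha> \<in> S \<Longrightarrow> \<beta> \<in> S \<Longrightarrow> \<alpha> + \<beta> = \<mu> + \<mu> \<Longrightarrow> \<alpha> = \<mu> \<and> \<beta> = \<mu>"
proof -
  define nsq :: "'n expo \<Rightarrow> real" where "nsq \<alpha> = (\<Sum>i\<in>UNIV. (real (Poly_Mapping.lookup \<alpha> i))\<^sup>2)" for \<alpha>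
  define d where "d = Max (expo_deg ` S)"
  define T where "T = {\<alpha>\<in>S. expo_deg \<alpha> = d}"
  have le_d: "expo_deg \<alpha> \<le> d" if "\<alpha> \<in> S" for \<alpha>
    using that assms by (simp add: d_def)
  have "d \<in> expo_deg ` S" using assms unfolding d_def by (intro Max_in) auto
  then have "finite T" "T \<noteq> {}" using assms by (auto simp: T_def)
  then have "Max (nsq ` T) \<in> nsq ` T" by (intro Max_in) auto
  then obtain \<mu> where "\<mu> \<in> T" "nsq \<mu> = Max (nsq ` T)" by force
  with \<open>finite T\<close> have \<mu>: "\<mu> \<in> T" "\<And>\<alpha>. \<alpha> \<in> T \<Longrightarrow> nsq \<alpha> \<le> nsq \<mu>" by auto
  show ?thesis
  proof (rule that)
    show "\<mu> \<in> S" using \<mu> by (simp add: T_def)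
    show "expo_deg \<alpha> \<le> expo_deg \<mu>" if "\<alpha> \<in> S" for \<alpha>
      using that \<mu> le_d by (simp add: T_def)
    fix \<alpha> \<beta> assume ab: "\<alpha> \<in> S" "\<beta> \<in> S" "\<alpha> + \<beta> = \<mu> + \<mu>"
    have "expo_deg \<alpha> + expo_deg \<beta> = d + d"
      using arg_cong[OF ab(3), of expo_deg] \<mu> by (simp add: expo_deg_add T_def)
    then have "\<alpha> \<in> T" "\<beta> \<in> T" using le_d[OF ab(1)] le_d[OF ab(2)] ab by (auto simp: T_def)
    then have le: "nsq \<alpha> + nsq \<beta> \<le> 2 * nsq \<mu>" using \<mu>(2)[of \<alpha>] \<mu>(2)[of \<beta>] by simp
    define dsq where "dsq = (\<Sum>i\<in>UNIV. (real (Poly_Mapping.lookup \<alpha> i) - real (Poly_Mapping.lookup \<beta> i))\<^sup>2)"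
    have "2 * (nsq \<alpha> + nsq \<beta>) = 4 * nsq \<mu> + dsq"
    proof -
      have "2 * ((real (Poly_Mapping.lookup \<alpha> i))\<^sup>2 + (real (Poly_Mapping.lookup \<beta> i))\<^sup>2)
        = 4 * (real (Poly_Mapping.lookup \<mu> i))\<^sup>2
          + (real (Poly_Mapping.lookup \<alpha> i) - real (Poly_Mapping.lookup \<beta> i))\<^sup>2" for i
      proof -
        have "Poly_Mapping.lookup \<alpha> i + Poly_Mapping.lookup \<beta> i = 2 * Poly_Mapping.lookup \<mu> i"
          using arg_cong[OF ab(3), of "\<lambda>\<gamma>. Poly_Mapping.lookup \<gamma> i"] by (simp add: lookup_add)
        then have eq: "real (Poly_Mapping.lookup \<alpha> i)
            = 2 * real (Poly_Mapping.lookup \<mu> i) - real (Poly_Mapping.lookup \<beta> i)" by linarith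
        show ?thesis unfolding eq by (simp add: power2_eq_square algebra_simps)
      qed
      then show ?thesis
        unfolding nsq_def dsq_def sum.distrib[symmetric] sum_distrib_left by (rule sum.cong[OF refl])
    qed
    moreover have "2 * (nsq \<alpha> + nsq \<beta>) \<le> 2 * (2 * nsq \<mu>)"
      using le by (rule mult_left_mono) simp
    ultimately have "dsq \<le> 0"
      by simp
    moreover have "0 \<le> dsq" unfolding dsq_def by (rule sum_nonneg) simp
    ultimately have "dsq = 0" by simp
    then have "\<forall>i. (real (Poly_Mapping.lookup \<alpha> i) - real (Poly_Mapping.lookup \<beta> i))\<^sup>2 = 0"
      unfolding dsq_def by (subst (asm) sum_nonneg_eq_0_iff) auto
    then have eq: "\<alpha> = \<beta>" by (intro poly_mapping_eqI) simp
    have "\<alpha> = \<mu>"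
    proof (rule poly_mapping_eqI)
      fix i
      show "Poly_Mapping.lookup \<alpha> i = Poly_Mapping.lookup \<mu> i"
        using arg_cong[OF ab(3), of "\<lambda>\<gamma>. Poly_Mapping.lookup \<gamma> i"] eq by (simp add: lookup_add)
    qed
    with eq show "\<alpha> = \<mu> \<and> \<beta> = \<mu>" by simp
  qed
qed

text \<open>Leading terms of a sum of squares do not cancel. At a vertex \<open>\<mu>\<close> of maximal degree, the only
  contributions to the coefficient of \<open>2\<mu>\<close> are the squares of the coefficients at \<open>\<mu>\<close>, and one
  of them is positive. So \<open>2\<mu>\<close> occurs in the sum.\<close>

lemma expo_deg_sum_of_squares:
  fixes R :: "nat \<Rightarrow> 'n::finite rpoly"
  assumes deg: "\<And>\<gamma>. \<gamma> \<in> Poly_Mapping.keys (\<Sum>l<r. R l * R l) \<Longrightarrow> expo_deg \<gamma> \<le> D"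
    and l: "l < r" and \<alpha>: "\<alpha> \<in> Poly_Mapping.keys (R l)"
  shows "2 * expo_deg \<alpha> \<le> D"
proof -
  define S where "S = (\<Union>l<r. Poly_Mapping.keys (R l))"
  have "\<alpha> \<in> S" "finite S" using l \<alpha> by (auto simp: S_def)
  then obtain \<mu> where \<mu>: "\<mu> \<in> S" "\<And>\<alpha>. \<alpha> \<in> S \<Longrightarrow> expo_deg \<alpha> \<le> expo_deg \<mu>"
    "\<And>\<alpha> \<beta>. \<alpha> \<in> S \<Longrightarrow> \<beta> \<in> S \<Longrightarrow> \<alpha> + \<beta> = \<mu> + \<mu> \<Longrightarrow> \<alpha> = \<mu> \<and> \<beta> = \<mu>"
    using expos_extreme_point[of S] by blast
  have sq: "Poly_Mapping.lookup (R l * R l) (\<mu> + \<mu>) = (Poly_Mapping.lookup (R l) \<mu>)\<^sup>2"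
    if "l < r" for l
  proof -
    let ?K = "Poly_Mapping.keys (R l)" and ?r = "Poly_Mapping.lookup (R l)"
    have KS: "?K \<subseteq> S" using that by (auto simp: S_def)
    have "Poly_Mapping.lookup (R l * R l) (\<mu> + \<mu>)
        = (\<Sum>\<alpha>\<in>?K. \<Sum>\<beta>\<in>?K. ?r \<alpha> * ?r \<beta> * (if \<alpha> + \<beta> = \<mu> + \<mu> then 1 else 0))"
      by (rule lookup_mult_keys)
    also have "\<dots> = (\<Sum>\<alpha>\<in>?K. \<Sum>\<beta>\<in>?K. if \<beta> = \<mu> then (if \<alpha> = \<mu> then ?r \<alpha> * ?r \<beta> else 0) else 0)"
    proof (intro sum.cong refl)
      fix \<alpha> \<beta> assume "\<alpha> \<in> ?K" "\<beta> \<in> ?K"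
      then have "\<alpha> + \<beta> = \<mu> + \<mu> \<longleftrightarrow> \<alpha> = \<mu> \<and> \<beta> = \<mu>" using KS \<mu>(3)[of \<alpha> \<beta>] by blast
      then show "?r \<alpha> * ?r \<beta> * (if \<alpha> + \<beta> = \<mu> + \<mu> then 1 else 0)
          = (if \<beta> = \<mu> then (if \<alpha> = \<mu> then ?r \<alpha> * ?r \<beta> else 0) else 0)" by simp
    qed
    also have "\<dots> = (?r \<mu>)\<^sup>2"
    proof (cases "\<mu> \<in> ?K")
      case False
      then have "?r \<mu> = 0" by (simp add: in_keys_iff)
      with False show ?thesis by simp
    qed (simp add: power2_eq_square)
    finally show ?thesis .
  qed
  have "Poly_Mapping.lookup (\<Sum>l<r. R l * R l) (\<mu> + \<mu>) = (\<Sum>l<r. (Poly_Mapping.lookup (R l) \<mu>)\<^sup>2)"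
    by (simp add: lookup_sum sq)
  moreover have "\<dots> > 0"
  proof -
    obtain l where "l < r" "\<mu> \<in> Poly_Mapping.keys (R l)" using \<mu>(1) by (auto simp: S_def)
    then show ?thesis by (intro sum_pos2[of _ l]) (auto simp: in_keys_iff)
  qed
  ultimately have "\<mu> + \<mu> \<in> Poly_Mapping.keys (\<Sum>l<r. R l * R l)"
    by (simp add: in_keys_iff)
  from deg[OF this] \<mu>(2)[OF \<open>\<alpha> \<in> S\<close>] show ?thesis by (simp add: expo_deg_add)
qed

lemma keys_poly_partial:
  assumes "\<beta> \<in> Poly_Mapping.keys (poly_partial i q)"
  shows "\<beta> + unit_expo i \<in> Poly_Mapping.keys q"
proof -
  have "\<beta> \<in> (\<Union>\<alpha>\<in>Poly_Mapping.keys q. Poly_Mapping.keys (Poly_Mapping.single (\<alpha> - unit_expo i)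
      (real (Poly_Mapping.lookup \<alpha> i) * Poly_Mapping.lookup q \<alpha>)))"
    by (rule subsetD[OF keys_sum assms[unfolded poly_partial_def]])
  then obtain \<alpha> where \<alpha>: "\<alpha> \<in> Poly_Mapping.keys q" "Poly_Mapping.lookup \<alpha> i \<noteq> 0" "\<beta> = \<alpha> - unit_expo i"
    by (auto split: if_splits)
  have "\<beta> + unit_expo i = \<alpha>"
    unfolding \<alpha>(3) using \<alpha>(2)
    by (intro poly_mapping_eqI) (auto simp: lookup_add lookup_minus unit_expo_def lookup_single when_def)
  with \<alpha> show ?thesis by simp
qed

text \<open>The diagonal entry \<open>\<partial>\<^sub>i\<^sup>2 q = \<Sum>\<^sub>l R\<^sub>l\<^sub>i\<^sup>2\<close> has degree at most \<open>2k - 2\<close>, which bounds every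
  entry of \<open>R\<close>.\<close>

lemma sos_convex_factor_degree:
  fixes q :: "'n::finite rpoly" and R :: "nat \<Rightarrow> 'n \<Rightarrow> 'n rpoly"
  assumes H: "\<And>i j. poly_partial i (poly_partial j q) = (\<Sum>l<r. R l i * R l j)"
    and "k \<ge> 1" "Poly_Mapping.keys q \<subseteq> expos_upto (2 * k)" "l < r"
  shows "Poly_Mapping.keys (R l i) \<subseteq> expos_upto (k - 1)"
proof
  fix \<alpha> assume \<alpha>: "\<alpha> \<in> Poly_Mapping.keys (R l i)"
  have "expo_deg \<gamma> \<le> 2 * k - 2" if "\<gamma> \<in> Poly_Mapping.keys (\<Sum>l<r. R l i * R l i)" for \<gamma>
  proof -
    have "\<gamma> \<in> Poly_Mapping.keys (poly_partial i (poly_partial i q))"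
      using that by (simp only: H)
    from keys_poly_partial[OF keys_poly_partial[OF this]]
    have "\<gamma> + unit_expo i + unit_expo i \<in> Poly_Mapping.keys q" .
    then show ?thesis using assms(3) by (auto simp: expos_upto_def expo_deg_add)
  qed
  from expo_deg_sum_of_squares[where R = "\<lambda>l. R l i", OF this assms(4) \<alpha>]
  show "\<alpha> \<in> expos_upto (k - 1)" by (simp add: expos_upto_def)
qed

text \<open>The summand at \<open>\<alpha>\<close> has the shape that the product rule produces for \<open>x\<^sup>\<alpha>\<close>.\<close>

lemma poly_eval_partial:
  "poly_eval (poly_partial i q) x = (\<Sum>\<alpha>\<in>Poly_Mapping.keys q. Poly_Mapping.lookup q \<alpha> *
     (real (Poly_Mapping.lookup \<alpha> i) * (x $ i) ^ (Poly_Mapping.lookup \<alpha> i - 1)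
       * (\<Prod>j\<in>UNIV - {i}. (x $ j) ^ Poly_Mapping.lookup \<alpha> j)))"
proof -
  have "monom_eval x (\<alpha> - unit_expo i) = (x $ i) ^ (Poly_Mapping.lookup \<alpha> i - 1)
       * (\<Prod>j\<in>UNIV - {i}. (x $ j) ^ Poly_Mapping.lookup \<alpha> j)" for \<alpha>
    unfolding monom_eval_def
    by (subst prod.remove[of _ i])
      (auto simp: lookup_minus unit_expo_def lookup_single when_def intro!: prod.cong)
  then show ?thesis
    unfolding poly_eval_eq_riesz poly_partial_def riesz_sum riesz_single by (simp add: mult_ac)
qed

lemma has_real_derivative_poly_eval_line:
  "((\<lambda>s. poly_eval q (v + s *\<^sub>R u)) has_real_derivative
     (\<Sum>i\<in>UNIV. u $ i * poly_eval (poly_partial i q) (v + s *\<^sub>R u))) (at s)"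
proof -
  have pow: "((\<lambda>s. (v $ i + s * u $ i) ^ e) has_real_derivative
      u $ i * (real e * (v $ i + s * u $ i) ^ (e - 1))) (at s)" for i e
    by (rule derivative_eq_intros refl | simp)+
  have mon: "((\<lambda>s. \<Prod>i\<in>UNIV. (v $ i + s * u $ i) ^ e i) has_real_derivative
      (\<Sum>i\<in>UNIV. u $ i * (real (e i) * (v $ i + s * u $ i) ^ (e i - 1))
        * (\<Prod>j\<in>UNIV - {i}. (v $ j + s * u $ j) ^ e j))) (at s)" for e
    by (rule has_field_derivative_prod) (rule pow)
  have "((\<lambda>s. poly_eval q (v + s *\<^sub>R u)) has_real_derivative
      (\<Sum>\<alpha>\<in>Poly_Mapping.keys q. Poly_Mapping.lookup q \<alpha> *
        (\<Sum>i\<in>UNIV. u $ i * (real (Poly_Mapping.lookup \<alpha> i)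
            * (v $ i + s * u $ i) ^ (Poly_Mapping.lookup \<alpha> i - 1))
          * (\<Prod>j\<in>UNIV - {i}. (v $ j + s * u $ j) ^ Poly_Mapping.lookup \<alpha> j)))) (at s)"
    unfolding poly_eval_def
    by (simp only: vector_add_component vector_scaleR_component real_scaleR_def)
      (intro DERIV_sum DERIV_cmult mon)
  also have "(\<Sum>\<alpha>\<in>Poly_Mapping.keys q. Poly_Mapping.lookup q \<alpha> *
        (\<Sum>i\<in>UNIV. u $ i * (real (Poly_Mapping.lookup \<alpha> i)
            * (v $ i + s * u $ i) ^ (Poly_Mapping.lookup \<alpha> i - 1))
          * (\<Prod>j\<in>UNIV - {i}. (v $ j + s * u $ j) ^ Poly_Mapping.lookup \<alpha> j)))
     = (\<Sum>i\<in>UNIV. u $ i * poly_eval (poly_partial i q) (v + s *\<^sub>R u))"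
    unfolding poly_eval_partial sum_distrib_left by (subst sum.swap) (simp add: mult_ac)
  finally show ?thesis .
qed

section \<open>Jensen's inequality for SOS-convex polynomials\<close>

lemma moment_matrix_psd_square:
  assumes "psd_on (expos_upto k) (moment_matrix y)" "Poly_Mapping.keys h \<subseteq> expos_upto k"
  shows "0 \<le> riesz (h * h) y"
proof -
  have "0 \<le> (\<Sum>\<alpha>\<in>expos_upto k. \<Sum>\<beta>\<in>expos_upto k.
      Poly_Mapping.lookup h \<alpha> * y (\<alpha> + \<beta>) * Poly_Mapping.lookup h \<beta>)"
    using assms(1) unfolding psd_on_def moment_matrix_def by blast
  also have "\<dots> = (\<Sum>\<alpha>\<in>expos_upto k. \<Sum>\<beta>\<in>Poly_Mapping.keys h.
      Poly_Mapping.lookup h \<alpha> * y (\<alpha> + \<beta>) * Poly_Mapping.lookup h \<beta>)"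
    using assms(2) by (intro sum.cong refl sum.mono_neutral_right) (auto simp: in_keys_iff)
  also have "\<dots> = (\<Sum>\<alpha>\<in>Poly_Mapping.keys h. \<Sum>\<beta>\<in>Poly_Mapping.keys h.
      Poly_Mapping.lookup h \<alpha> * y (\<alpha> + \<beta>) * Poly_Mapping.lookup h \<beta>)"
    using assms(2) by (intro sum.mono_neutral_right) (auto simp: in_keys_iff)
  also have "\<dots> = riesz (h * h) y"
    by (simp add: riesz_mult mult_ac)
  finally show ?thesis .
qed

text \<open>Along the segments from \<open>v\<close> to the quadrature nodes, the weighted sum \<open>g\<close> of the values of \<open>q\<close>
  is a function of one variable with \<open>g'(0) = 0\<close>. It is convex even though single weights may be
  negative, since its second derivative is the Riesz functional of a sum of squares.\<close>

lemma sos_convex_jensen: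
  fixes q :: "'n::finite rpoly"
  assumes "sos_convex q" and deg: "Poly_Mapping.keys q \<subseteq> expos_upto (2 * k)" and k: "k \<ge> 1"
    and y0: "y 0 = 1" and psd: "psd_on (expos_upto k) (moment_matrix y)"
  shows "poly_eval q (\<chi> i. y (unit_expo i)) \<le> riesz q y"
proof -
  define v :: "real ^ 'n" where "v = (\<chi> i. y (unit_expo i))"
  obtain r and R :: "nat \<Rightarrow> 'n \<Rightarrow> 'n rpoly" where
    H: "\<And>i j. poly_partial i (poly_partial j q) = (\<Sum>l<r. R l i * R l j)"
    using assms(1) unfolding sos_convex_def by blast
  obtain F :: "('n \<Rightarrow> nat) set" and w and P :: "('n \<Rightarrow> nat) \<Rightarrow> real ^ 'n" where
    quad: "\<And>q. Poly_Mapping.keys q \<subseteq> expos_upto (2 * k) \<Longrightarrow> riesz q y = (\<Sum>f\<in>F. w f * poly_eval q (P f))"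
    by (rule quadrature[of "2 * k" y]) (rule that)
  have w_sum: "(\<Sum>f\<in>F. w f) = 1"
    using quad[of "monom_poly 0"] y0
    by (simp add: keys_monom_poly riesz_monom_poly poly_eval_monom_poly)
  have w_mean: "(\<Sum>f\<in>F. w f * P f $ i) = v $ i" for i
    using quad[of "monom_poly (unit_expo i)"] k
    by (simp add: keys_monom_poly riesz_monom_poly poly_eval_monom_poly expos_upto_def v_def)
  \<comment> \<open>The weights are nonnegative in the aggregate: this is where the moment matrix enters.\<close>
  have w_square: "0 \<le> (\<Sum>f\<in>F. w f * (h (P f))\<^sup>2)" if h: "h \<in> polyfuns k" for h
  proof -
    obtain p where p: "h = poly_eval p" "Poly_Mapping.keys p \<subseteq> expos_upto k"
      using h by (auto simp: polyfuns_def)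
    have "Poly_Mapping.keys (p * p) \<subseteq> expos_upto (2 * k)"
      using keys_mult_subset_expos_upto[OF p(2) p(2)] by (simp only: mult_2)
    from quad[OF this] moment_matrix_psd_square[OF psd p(2)] show ?thesis
      by (simp add: p poly_eval_mult power2_eq_square)
  qed
  define u where "u f = P f - v" for f
  define g where "g s = (\<Sum>f\<in>F. w f * poly_eval q (v + s *\<^sub>R u f))" for s
  define g' where "g' s = (\<Sum>f\<in>F. w f *
    (\<Sum>i\<in>UNIV. u f $ i * poly_eval (poly_partial i q) (v + s *\<^sub>R u f)))" for s
  define g'' where "g'' s = (\<Sum>f\<in>F. w f * (\<Sum>i\<in>UNIV. u f $ i *
    (\<Sum>j\<in>UNIV. u f $ j * poly_eval (poly_partial j (poly_partial i q)) (v + s *\<^sub>R u f))))" for s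
  have dg: "(g has_real_derivative g' s) (at s)" for s
    unfolding g_def g'_def
    by (intro DERIV_sum DERIV_cmult has_real_derivative_poly_eval_line)
  have dg': "(g' has_real_derivative g'' s) (at s)" for s
    unfolding g'_def g''_def
    by (intro DERIV_sum DERIV_cmult has_real_derivative_poly_eval_line)
  have g''_nonneg: "0 \<le> g'' s" for s
  proof -
    \<comment> \<open>The entries of \<open>R(v + s(x - v)) (x - v)\<close>, as polynomials in \<open>x\<close> for fixed \<open>s\<close>.\<close>
    define h where "h l x = (\<Sum>i\<in>UNIV. (x - v) $ i * poly_eval (R l i) (v + s *\<^sub>R (x - v)))" for l x
    have h: "h l \<in> polyfuns k" if "l < r" for l
    proof -
      have "poly_eval (R l i) \<in> polyfuns (k - 1)" for i
        unfolding polyfuns_def using sos_convex_factor_degree[OF H k deg that] by blast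
      then have "(\<lambda>x. (x - v) $ i * poly_eval (R l i) (v + s *\<^sub>R (x - v))) \<in> polyfuns (1 + (k - 1))" for i
        by (rule polyfuns_mult[OF polyfuns_diff_coord polyfuns_homothety])
      then show ?thesis unfolding h_def using k by (intro polyfuns_sum) simp
    qed
    have "(\<Sum>i\<in>UNIV. u f $ i *
        (\<Sum>j\<in>UNIV. u f $ j * poly_eval (poly_partial j (poly_partial i q)) (v + s *\<^sub>R u f)))
        = (\<Sum>l<r. (h l (P f))\<^sup>2)" (is "?L = _") for f
    proof -
      let ?R = "\<lambda>l i. poly_eval (R l i) (v + s *\<^sub>R u f)"
      have "?L = (\<Sum>i\<in>UNIV. \<Sum>j\<in>UNIV. \<Sum>l<r. (u f $ i * ?R l i) * (u f $ j * ?R l j))"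
        by (simp add: H poly_eval_sum poly_eval_mult sum_distrib_left mult_ac)
      also have "\<dots> = (\<Sum>i\<in>UNIV. \<Sum>l<r. \<Sum>j\<in>UNIV. (u f $ i * ?R l i) * (u f $ j * ?R l j))"
        by (intro sum.cong refl sum.swap)
      also have "\<dots> = (\<Sum>l<r. \<Sum>i\<in>UNIV. \<Sum>j\<in>UNIV. (u f $ i * ?R l i) * (u f $ j * ?R l j))"
        by (rule sum.swap)
      also have "\<dots> = (\<Sum>l<r. (h l (P f))\<^sup>2)"
        by (simp add: h_def u_def power2_eq_square sum_product)
      finally show ?thesis .
    qed
    then have "g'' s = (\<Sum>f\<in>F. w f * (\<Sum>l<r. (h l (P f))\<^sup>2))"
      by (simp add: g''_def)
    also have "\<dots> = (\<Sum>l<r. \<Sum>f\<in>F. w f * (h l (P f))\<^sup>2)"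
      unfolding sum_distrib_left by (rule sum.swap)
    also have "\<dots> \<ge> 0"
      by (rule sum_nonneg) (simp add: w_square h)
    finally show ?thesis .
  qed
  have g'0: "g' 0 = 0"
  proof -
    \<comment> \<open>The quadrature is centred at \<open>v\<close>, because \<open>y\<^sub>0 = 1\<close> and \<open>v\<close> collects the first moments.\<close>
    have mean: "(\<Sum>f\<in>F. w f * u f $ i) = 0" for i
      using w_mean[of i] w_sum
      by (simp add: u_def right_diff_distrib sum_subtractf flip: sum_distrib_right)
    have "g' 0 = (\<Sum>i\<in>UNIV. (\<Sum>f\<in>F. w f * u f $ i) * poly_eval (poly_partial i q) v)"
      unfolding g'_def sum_distrib_left sum_distrib_right
      by (subst sum.swap) (simp add: mult_ac)
    then show ?thesis by (simp add: mean)
  qed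
  have "g' 0 \<le> g' s" if "0 \<le> s" for s
    using that dg' g''_nonneg by (intro DERIV_nonneg_imp_nondecreasing[of 0 s g']) auto
  then have "g 0 \<le> g 1"
    using dg g'0 by (intro DERIV_nonneg_imp_nondecreasing[of 0 1 g]) force+
  moreover have "g 0 = poly_eval q v"
    using w_sum by (simp add: g_def flip: sum_distrib_right)
  moreover have "g 1 = riesz q y"
    by (simp add: g_def u_def quad[OF deg])
  ultimately show ?thesis by (simp add: v_def)
qed

lemma sos_concave_jensen:
  fixes q :: "'n::finite rpoly"
  assumes "sos_concave q" "Poly_Mapping.keys q \<subseteq> expos_upto (2 * k)" "k \<ge> 1"
    "y 0 = 1" "psd_on (expos_upto k) (moment_matrix y)"
  shows "riesz q y \<le> poly_eval q (\<chi> i. y (unit_expo i))"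
  using sos_convex_jensen[of "- q" k y] assms
  by (simp add: sos_concave_def keys_uminus_rpoly poly_eval_uminus riesz_uminus)

lemma riesz_affine:
  fixes q :: "'n::finite rpoly"
  assumes "poly_deg q \<le> 1" "y 0 = 1"
  shows "riesz q y = poly_eval q (\<chi> i. y (unit_expo i))"
  unfolding poly_eval_eq_riesz
proof (rule riesz_cong)
  fix \<alpha> assume "\<alpha> \<in> Poly_Mapping.keys q"
  then have "expo_deg \<alpha> \<le> 1"
    using assms(1) by (auto simp: expos_upto_def simp flip: keys_subset_expos_upto_iff)
  then show "y \<alpha> = monom_eval (\<chi> i. y (unit_expo i)) \<alpha>"
    by (cases rule: expo_deg_le_1_cases) (auto simp: assms(2))
qed

section \<open>Exactness of the moment relaxations\<close>

lemma ext_log_mono: "s \<le> t \<Longrightarrow> ext_log s \<le> ext_log t"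
  by (auto simp: ext_log_def)

lemma weighted_log_sum_mono:
  assumes "\<forall>i\<in>{1..m}. a i > 0" "\<And>i. i \<in> {1..m} \<Longrightarrow> s i \<le> t i"
  shows "weighted_log_sum m a s \<le> weighted_log_sum m a t"
  unfolding weighted_log_sum_def
  using assms by (intro sum_mono ereal_mult_left_mono ext_log_mono) (auto simp: less_imp_le)

lemma poly_deg_le_half_deg: "poly_deg q \<le> 2 * half_deg q"
  unfolding half_deg_def by linarith

lemma psd_on_rank_one:
  assumes "r \<ge> 0" "\<And>i j. i \<in> S \<Longrightarrow> j \<in> S \<Longrightarrow> A i j = r * (b i * b j)"
  shows "psd_on S A"
  unfolding psd_on_def
proof (intro conjI ballI allI)
  fix v
  have "(\<Sum>i\<in>S. \<Sum>j\<in>S. v i * A i j * v j) = (\<Sum>i\<in>S. \<Sum>j\<in>S. v i * (r * (b i * b j)) * v j)"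
    by (intro sum.cong refl) (simp add: assms(2))
  also have "\<dots> = r * (\<Sum>i\<in>S. v i * b i)\<^sup>2"
    by (simp add: power2_eq_square sum_product sum_distrib_left mult_ac)
  finally show "0 \<le> (\<Sum>i\<in>S. \<Sum>j\<in>S. v i * A i j * v j)"
    using assms(1) by simp
qed (simp add: assms(2))

lemma psd_on_diagonal:
  assumes "psd_on S A" "finite S" "s \<in> S"
  shows "0 \<le> A s s"
proof -
  have "\<forall>v. 0 \<le> (\<Sum>i\<in>S. \<Sum>j\<in>S. v i * A i j * v j)"
    using assms(1) unfolding psd_on_def by blast
  from this[rule_format, of "\<lambda>i. if i = s then 1 else 0"]
  have "0 \<le> (\<Sum>i\<in>S. \<Sum>j\<in>S. (if i = s then 1 else 0) * A i j * (if j = s then 1 else 0))" .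
  also have "\<dots> = (\<Sum>i\<in>S. if i = s then (\<Sum>j\<in>S. if j = s then A i j else 0) else 0)"
    by (intro sum.cong refl) (auto intro: sum.cong)
  also have "\<dots> = A s s"
    using assms by simp
  finally show ?thesis .
qed

text \<open>The moment matrix and the localizing matrices of a point mass have rank one, the latter scaled by
  the value of the constraint. The bound \<open>half_deg (c j) \<le> k\<close> keeps the localizing entries within
  degree \<open>2 * k\<close>; for larger degrees the natural subtraction would truncate.\<close>

lemma moments_of_point_feasible:
  fixes c :: "'l \<Rightarrow> 'n::finite rpoly"
  assumes x: "x \<in> feasible_set E I c" and hd: "\<And>j. j \<in> E \<union> I \<Longrightarrow> half_deg (c j) \<le> k"
  shows "restrict (monom_eval x) (expos_upto (2 * k)) \<in> mom_feasible E I c k"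
proof -
  let ?y = "restrict (monom_eval x) (expos_upto (2 * k))"
  have loc: "localizing_matrix (c j) ?y \<alpha> \<beta> = poly_eval (c j) x * (monom_eval x \<alpha> * monom_eval x \<beta>)"
    if "j \<in> E \<union> I" "\<alpha> \<in> expos_upto (k - half_deg (c j))" "\<beta> \<in> expos_upto (k - half_deg (c j))"
    for j \<alpha> \<beta>
  proof -
    let ?q = "c j * monom_poly \<alpha> * monom_poly \<beta>"
    have "Poly_Mapping.keys ?q \<subseteq> expos_upto (2 * k)"
    proof -
      let ?s = "k - half_deg (c j)"
      have "Poly_Mapping.keys (c j) \<subseteq> expos_upto (2 * half_deg (c j))"
        unfolding keys_subset_expos_upto_iff by (rule poly_deg_le_half_deg)
      moreover have "Poly_Mapping.keys (monom_poly \<alpha>) \<subseteq> expos_upto ?s"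
        "Poly_Mapping.keys (monom_poly \<beta>) \<subseteq> expos_upto ?s"
        using that by (auto simp: keys_monom_poly)
      ultimately have "Poly_Mapping.keys ?q \<subseteq> expos_upto (2 * half_deg (c j) + ?s + ?s)"
        by (intro keys_mult_subset_expos_upto)
      also have "2 * half_deg (c j) + ?s + ?s = 2 * k"
        using hd[OF that(1)] by simp
      finally show ?thesis .
    qed
    then have "riesz ?q ?y = poly_eval ?q x"
      unfolding poly_eval_eq_riesz by (intro riesz_cong) auto
    then show ?thesis
      by (simp add: localizing_matrix_def poly_eval_mult poly_eval_monom_poly mult_ac)
  qed
  have mom: "moment_matrix ?y \<alpha> \<beta> = 1 * (monom_eval x \<alpha> * monom_eval x \<beta>)"
    if "\<alpha> \<in> expos_upto k" "\<beta> \<in> expos_upto k" for \<alpha> \<beta>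
    using that by (auto simp: moment_matrix_def monom_eval_add expos_upto_def expo_deg_add)
  have "psd_on (expos_upto k) (moment_matrix ?y)"
    using mom by (intro psd_on_rank_one[of 1 _ _ "monom_eval x"]) auto
  moreover have "psd_on (expos_upto (k - half_deg (c j))) (localizing_matrix (c j) ?y)" if "j \<in> I" for j
    using loc[of j] that x
    by (intro psd_on_rank_one[of "poly_eval (c j) x" _ _ "monom_eval x"]) (auto simp: feasible_set_def)
  ultimately show ?thesis
    using x by (auto simp: mom_feasible_def loc feasible_set_def)
qed

theorem theorem4p5:
  fixes m :: nat and a :: "nat \<Rightarrow> real"
    and p :: "nat \<Rightarrow> 'n::finite rpoly"
    and E I :: "'l set" and c :: "'l \<Rightarrow> 'n rpoly"
  assumes "m \<ge> 1"
    and "\<forall>i\<in>{1..m}. a i > 0"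
    and "finite E" and "finite I" and "E \<inter> I = {}"
    and "\<forall>i\<in>{1..m}. \<forall>x\<in>feasible_set E I c. poly_eval (p i) x \<ge> 0"
    and "\<exists>x\<in>feasible_set E I c. \<forall>i\<in>{1..m}. poly_eval (p i) x > 0"
    and "\<forall>j\<in>I. sos_concave (c j)"
    and "\<forall>j\<in>E. poly_deg (c j) \<le> 1"
    and "\<forall>i\<in>{1..m}. sos_concave (p i)"
  shows "\<forall>k\<ge>min_order m p E I c.
    f_mom m a p E I c k = f_max m a p E I c \<and>
    (\<forall>y. is_arg_max (mom_obj m a p) (\<lambda>y. y \<in> mom_feasible E I c k) y \<longrightarrow>
       is_arg_max (log_poly_obj m a p) (\<lambda>x. x \<in> feasible_set E I c) (\<chi> i. y (unit_expo i)))"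
proof (intro allI impI)
  fix k assume k: "min_order m p E I c \<le> k"
  have "half_deg q \<le> min_order m p E I c" if "q \<in> p ` {1..m} \<union> c ` (E \<union> I)" for q
    unfolding min_order_def using that assms(3,4) by (intro Max_ge) auto
  then have hd: "half_deg q \<le> k" if "q \<in> p ` {1..m} \<union> c ` (E \<union> I)" for q
    using that k order_trans by blast
  have "1 \<le> min_order m p E I c"
    unfolding min_order_def using assms(3,4) by (intro Max_ge) auto
  with k have k1: "k \<ge> 1" by linarith
  have keys: "Poly_Mapping.keys q \<subseteq> expos_upto (2 * k)" if "q \<in> p ` {1..m} \<union> c ` (E \<union> I)" for q
    unfolding keys_subset_expos_upto_iff using poly_deg_le_half_deg[of q] hd[OF that] by linarith

  let ?y = "\<lambda>x. restrict (monom_eval x) (expos_upto (2 * k))"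
  let ?v = "\<lambda>y. \<chi> i. y (unit_expo i)"

  have up: "?y x \<in> mom_feasible E I c k \<and> mom_obj m a p (?y x) = log_poly_obj m a p x"
    if "x \<in> feasible_set E I c" for x
  proof
    show "?y x \<in> mom_feasible E I c k"
      using that hd by (intro moments_of_point_feasible) auto
    have "riesz (p i) (?y x) = poly_eval (p i) x" if "i \<in> {1..m}" for i
      unfolding poly_eval_eq_riesz using keys[of "p i"] that by (intro riesz_cong) auto
    then show "mom_obj m a p (?y x) = log_poly_obj m a p x"
      by (simp add: mom_obj_def log_poly_obj_def weighted_log_sum_def)
  qed

  have down: "?v y \<in> feasible_set E I c \<and> mom_obj m a p y \<le> log_poly_obj m a p (?v y)"
    if y: "y \<in> mom_feasible E I c k" for y
  proof
    have y0: "y 0 = 1" and psd: "psd_on (expos_upto k) (moment_matrix y)"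
      using y by (auto simp: mom_feasible_def)
    have jensen: "riesz q y \<le> poly_eval q (?v y)"
      if "q \<in> p ` {1..m} \<union> c ` (E \<union> I)" "sos_concave q" for q
      using sos_concave_jensen[OF that(2) keys[OF that(1)] k1 y0 psd] .
    have corner: "localizing_matrix q y 0 0 = riesz q y" for q
      by (simp add: localizing_matrix_def monom_poly_def single_one)
    have "poly_eval (c j) (?v y) = 0" if "j \<in> E" for j
      using y that riesz_affine[of "c j" y] assms(9) y0 corner[of "c j"]
      by (fastforce simp: mom_feasible_def)
    moreover have "poly_eval (c j) (?v y) \<ge> 0" if "j \<in> I" for j
    proof -
      have "psd_on (expos_upto (k - half_deg (c j))) (localizing_matrix (c j) y)"
        using y that by (auto simp: mom_feasible_def)
      then have "0 \<le> localizing_matrix (c j) y 0 0"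
        by (rule psd_on_diagonal) auto
      also have "\<dots> = riesz (c j) y"
        by (rule corner)
      also have "\<dots> \<le> poly_eval (c j) (?v y)"
        using that assms(8) by (intro jensen) auto
      finally show ?thesis .
    qed
    ultimately show "?v y \<in> feasible_set E I c"
      by (simp add: feasible_set_def)
    show "mom_obj m a p y \<le> log_poly_obj m a p (?v y)"
      unfolding mom_obj_def log_poly_obj_def
      using assms(2,10) by (intro weighted_log_sum_mono jensen) auto
  qed

  show "f_mom m a p E I c k = f_max m a p E I c \<and>
    (\<forall>y. is_arg_max (mom_obj m a p) (\<lambda>y. y \<in> mom_feasible E I c k) y \<longrightarrow>
       is_arg_max (log_poly_obj m a p) (\<lambda>x. x \<in> feasible_set E I c) (?v y))"
  proof (intro conjI allI impI antisym)
    show "f_mom m a p E I c k \<le> f_max m a p E I c"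
      unfolding f_mom_def f_max_def using down by (intro SUP_mono) blast
    show "f_max m a p E I c \<le> f_mom m a p E I c k"
      unfolding f_mom_def f_max_def using up by (intro SUP_mono) (metis order_refl)
  next
    fix y assume "is_arg_max (mom_obj m a p) (\<lambda>y. y \<in> mom_feasible E I c k) y"
    then have y: "y \<in> mom_feasible E I c k"
      and opt: "\<And>z. z \<in> mom_feasible E I c k \<Longrightarrow> mom_obj m a p z \<le> mom_obj m a p y"
      by (auto simp: is_arg_max_def not_less)
    have "log_poly_obj m a p x \<le> log_poly_obj m a p (?v y)" if "x \<in> feasible_set E I c" for x
      using up[OF that] opt[of "?y x"] down[OF y] by (metis order_trans)
    then show "is_arg_max (log_poly_obj m a p) (\<lambda>x. x \<in> feasible_set E I c) (?v y)"
      using down[OF y] by (auto simp: is_arg_max_def not_less)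
  qed
qed

end
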